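(* Let $N\ge1$ be an integer, let $B,R>0$, let $X\subseteq\mathbb{R}^n$ be a nonempty closed convex set, and let $f$ be a convex function whose domain contains $X$, with $\partial f(x)\ne\emptyset$ for every $x\in X$ and with $B$-bounded subgradients on $X$. Let $x^*$ be a minimizer of $f$ over $X$ and let $x^1\in X$ satisfy $\|x^1-x^*\|\le R$. Let $x^2,\dots,x^{N+1}$ be generated by $$x^{k+1}=P_X\left(x^k-h_kg^k\right),\qquad g^k\in\partial f(x^k),\qquad h_k=\frac{R\,(N+1-k)}{B\sqrt{(N+1)^3}},\qquad k=1,\dots,N.$$ Then $$f(x^{N+1})-f(x^* )\le\frac{BR}{\sqrt{N+1}}.$$
   Context: $\|\cdot\|$ is the Euclidean norm and $P_X$ is the Euclidean projection onto $X$. The subdifferential is $\partial f(x)=\{g\in\mathbb{R}^n : f(y)\ge f(x)+\langle g,y-x\rangle \text{ for all } y\in\mathrm{dom} f\}$. The function $f$ has $B$-bounded subgradients on $X$ if $\|g\|\le B$ for all $x\in X$ and $g\in\partial f(x)$. *)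

theory Defs
  imports "HOL-Analysis.Analysis"
begin

text \<open>A convex function with domain \<open>D\<close> is a total function \<open>f\<close> with \<open>convex_on D f\<close>;
  the values of \<open>f\<close> outside \<open>D\<close> (where \<open>f = +\<infinity>\<close> in the extended-value convention) are irrelevant.\<close>

definition subdifferential ::
    "'a::real_inner set \<Rightarrow> ('a \<Rightarrow> real) \<Rightarrow> 'a \<Rightarrow> 'a set" where
  "subdifferential D f x = {g. \<forall>y\<in>D. f y \<ge> f x + g \<bullet> (y - x)}"

definition bounded_subgradients_on ::
    "'a::real_inner set \<Rightarrow> ('a \<Rightarrow> real) \<Rightarrow> real \<Rightarrow> 'a set \<Rightarrow> bool" where
  "bounded_subgradients_on D f B X \<longleftrightarrow> (\<forall>x\<in>X. \<forall>g\<in>subdifferential D f x. norm g \<le> B)"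

end

theory Submission
  imports Defs
begin

text \<open>Instead of comparing the iterates with the minimizer itself, compare \<open>x\<^sup>m\<^sup>+\<^sup>1\<close> with a moving
  reference point \<open>z\<close>, which starts at the minimizer \<open>x\<^sup>*\<close> and is pulled towards the current iterate
  by \<open>z' = (w z + x\<^sup>m) / (w + 1)\<close>, \<open>w = N + 1 - m\<close>. The linearly decaying step sizes \<open>h = c w\<close> are
  precisely those for which the increment of the potential
  \<open>\<parallel>x\<^sup>m\<^sup>+\<^sup>1 - z\<parallel>\<^sup>2 / w\<^sup>2 + 2 c (f(z) - f(x\<^sup>*))\<close> is at most \<open>c\<^sup>2 B\<^sup>2\<close>, since convexity at \<open>z'\<close>
  cancels all function values. When \<open>w\<close> reaches \<open>1\<close>, one subgradient inequality
  at the last iterate turns the bound on the potential into the bound on its function value.\<close>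

text \<open>The projection is nonexpansive and fixes \<open>z\<close>, so it can only bring the
  point closer to \<open>z\<close>. Expanding the square leaves a cross term, which the subgradient
  inequality at \<open>x\<close> controls.\<close>

lemma projected_subgradient_step:
  fixes X D :: "'a::euclidean_space set"
  assumes X: "closed X" "convex X" "X \<subseteq> D"
    and z: "z \<in> X" and g: "g \<in> subdifferential D f x" "norm g \<le> B" and h: "h \<ge> 0"
  shows "(norm (closest_point X (x - h *\<^sub>R g) - z))\<^sup>2
           \<le> (norm (x - z))\<^sup>2 - 2 * h * (f x - f z) + h\<^sup>2 * B\<^sup>2"
proof -
  have "dist (closest_point X (x - h *\<^sub>R g)) (closest_point X z) \<le> dist (x - h *\<^sub>R g) z"
    using X z by (intro closest_point_lipschitz) auto
  then have "(norm (closest_point X (x - h *\<^sub>R g) - z))\<^sup>2 \<le> (norm (x - h *\<^sub>R g - z))\<^sup>2"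
    using z by (simp add: closest_point_self dist_norm power_mono)
  also have "\<dots> = (norm (x - z))\<^sup>2 + 2 * h * (g \<bullet> (z - x)) + h\<^sup>2 * (norm g)\<^sup>2"
    unfolding power2_norm_eq_inner
    by (simp add: inner_diff_left inner_diff_right inner_commute algebra_simps power2_eq_square)
  also have "\<dots> \<le> (norm (x - z))\<^sup>2 + 2 * h * (f z - f x) + h\<^sup>2 * B\<^sup>2"
  proof -
    have "f x + g \<bullet> (z - x) \<le> f z"
      using g z X by (auto simp: subdifferential_def)
    then have "2 * h * (g \<bullet> (z - x)) \<le> 2 * h * (f z - f x)"
      using h by (intro mult_left_mono) auto
    moreover have "h\<^sup>2 * (norm g)\<^sup>2 \<le> h\<^sup>2 * B\<^sup>2"
      using g by (intro mult_left_mono power_mono) auto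
    ultimately show ?thesis by linarith
  qed
  finally show ?thesis by (simp add: algebra_simps)
qed

text \<open>Moving the reference from \<open>z\<close> to \<open>z'\<close> shrinks its distance to
  \<open>x\<close> by \<open>w / (w + 1)\<close>, the ratio of the two normalisations, so the
  distance term does not change. The projected step, measured from \<open>z'\<close>, then gains
  enough to pay for the change of \<open>f\<close> at the reference.\<close>

lemma potential_step:
  fixes X D :: "'a::euclidean_space set"
  assumes X: "closed X" "convex X" "X \<subseteq> D" and f: "convex_on D f"
    and mem: "x \<in> X" "z \<in> X"
    and g: "g \<in> subdifferential D f x" "norm g \<le> B"
    and w: "w > 0" and c: "c \<ge> 0"
  shows "\<exists>z'\<in>X. (norm (closest_point X (x - (c * w) *\<^sub>R g) - z'))\<^sup>2 / w\<^sup>2 + 2 * c * f z'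
           \<le> (norm (x - z))\<^sup>2 / (w + 1)\<^sup>2 + 2 * c * f z + c\<^sup>2 * B\<^sup>2"
proof -
  define t where "t = w / (w + 1)"
  define z' where "z' = t *\<^sub>R z + (1 - t) *\<^sub>R x"
  have t: "0 \<le> t" "t \<le> 1"
    using w by (auto simp: t_def)
  have z': "z' \<in> X"
    unfolding z'_def using X mem t by (intro convexD) auto
  have "f z' \<le> t * f z + (1 - t) * f x"
    using f X mem t unfolding convex_on_def z'_def by (auto simp: subset_iff)
  \<comment> \<open>Clearing denominators gives \<open>w * (f z' - f z) \<le> f x - f z'\<close>:
    the change of \<open>f\<close> at the reference is bounded by the gap that the step
    exploits.\<close>
  then have "(w + 1) * f z' \<le> (w + 1) * (t * f z + (1 - t) * f x)"
    using w by (intro mult_left_mono) auto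
  also have "\<dots> = w * f z + f x"
  proof -
    have "(w + 1) * t = w" "(w + 1) * (1 - t) = 1"
      using w by (simp_all add: t_def right_diff_distrib)
    then show ?thesis by (simp add: distrib_left[of "w + 1"] mult.assoc[symmetric])
  qed
  finally have conv: "f z' - f z \<le> (f x - f z') / w"
    using w by (simp add: field_simps)
  have "x - z' = t *\<^sub>R (x - z)"
    by (simp add: z'_def algebra_simps)
  then have "norm (x - z') / w = norm (x - z) / (w + 1)"
    using w by (simp add: t_def)
  then have dist: "(norm (x - z'))\<^sup>2 / w\<^sup>2 = (norm (x - z))\<^sup>2 / (w + 1)\<^sup>2"
    by (metis power_divide)
  have "(norm (closest_point X (x - (c * w) *\<^sub>R g) - z'))\<^sup>2 / w\<^sup>2
          \<le> ((norm (x - z'))\<^sup>2 - 2 * (c * w) * (f x - f z') + (c * w)\<^sup>2 * B\<^sup>2) / w\<^sup>2"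
    using projected_subgradient_step[OF X z' g, of "c * w"] w c
    by (intro divide_right_mono) auto
  \<comment> \<open>With step size \<open>c * w\<close>, division by the square of \<open>w\<close>
    leaves the factor \<open>1 / w\<close> that \<open>conv\<close> needs, and an error term
    independent of \<open>w\<close>.\<close>
  also have "\<dots> = (norm (x - z))\<^sup>2 / (w + 1)\<^sup>2 - 2 * c * ((f x - f z') / w) + c\<^sup>2 * B\<^sup>2"
    unfolding dist[symmetric] using w by (simp add: field_simps power2_eq_square)
  also have "\<dots> \<le> (norm (x - z))\<^sup>2 / (w + 1)\<^sup>2 - 2 * c * (f z' - f z) + c\<^sup>2 * B\<^sup>2"
    using mult_left_mono[OF conv, of "2 * c"] c by simp
  finally show ?thesis
    using z' by (intro bexI[of _ z']) (auto simp: algebra_simps)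
qed

theorem theorem5p1:
  fixes N :: nat and B R :: real
    and X D :: "(real ^ 'n) set" and f :: "real ^ 'n \<Rightarrow> real"
    and xstar :: "real ^ 'n" and x g :: "nat \<Rightarrow> real ^ 'n" and h :: "nat \<Rightarrow> real"
  assumes "N \<ge> 1" and "B > 0" and "R > 0"
    and "X \<noteq> {}" and "closed X" and "convex X"
    and "convex_on D f" and "X \<subseteq> D"
    and "\<forall>y\<in>X. subdifferential D f y \<noteq> {}"
    and "bounded_subgradients_on D f B X"
    and "is_arg_min f (\<lambda>y. y \<in> X) xstar"
    and "x 1 \<in> X" and "norm (x 1 - xstar) \<le> R"
    and "\<forall>k\<in>{1..N}. g k \<in> subdifferential D f (x k)"
    and "\<forall>k\<in>{1..N}. h k = R * (real N + 1 - real k) / (B * sqrt ((real N + 1) ^ 3))"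
    and "\<forall>k\<in>{1..N}. x (k + 1) = closest_point X (x k - h k *\<^sub>R g k)"
  shows "f (x (N + 1)) - f xstar \<le> B * R / sqrt (real N + 1)"
proof -
  define M where "M = real N + 1"
  \<comment> \<open>The step sizes are \<open>c * (M - k)\<close>. This \<open>c\<close> balances
    the initial distance term against \<open>M\<close> error terms: both equal
    \<open>R\<^sup>2 / M\<^sup>2\<close>.\<close>
  define c where "c = R / (B * sqrt (M ^ 3))"
  have M: "M > 0" by (simp add: M_def)
  have c: "c > 0" using \<open>B > 0\<close> \<open>R > 0\<close> M by (simp add: c_def)
  have bound: "norm v \<le> B" if "y \<in> X" "v \<in> subdifferential D f y" for y v
    using assms(10) that by (auto simp: bounded_subgradients_on_def)
  have xstar: "xstar \<in> X"
    using assms(11) by (simp add: is_arg_min_def)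
  have step: "x (k + 1) = closest_point X (x k - (c * (M - real k)) *\<^sub>R g k)"
    if "k \<in> {1..N}" for k
    using assms(15,16) that by (simp add: c_def M_def)
  have x_mem: "x (m + 1) \<in> X" if "m \<le> N" for m
  proof (cases m)
    case 0
    then show ?thesis using assms(12) by simp
  next
    case (Suc k)
    then show ?thesis
      using step[of m] that closest_point_in_set[OF \<open>closed X\<close> \<open>X \<noteq> {}\<close>] by simp
  qed
  \<comment> \<open>After \<open>m\<close> steps the current iterate is \<open>x (m + 1)\<close>.
    The normalisation \<open>M - m\<close> falls from \<open>M\<close>, with reference
    \<open>xstar\<close>, to \<open>1\<close> at \<open>m = N\<close>.\<close>
  have potential: "\<exists>z\<in>X. (norm (x (m + 1) - z))\<^sup>2 / (M - real m)\<^sup>2 + 2 * c * f z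
      \<le> R\<^sup>2 / M\<^sup>2 + 2 * c * f xstar + real m * (c\<^sup>2 * B\<^sup>2)" if "m \<le> N" for m
    using that
  proof (induction m)
    case 0
    have "(norm (x 1 - xstar))\<^sup>2 / M\<^sup>2 \<le> R\<^sup>2 / M\<^sup>2"
      using assms(13) by (intro divide_right_mono power_mono) auto
    then show ?case using xstar by (auto intro!: bexI[of _ xstar])
  next
    case (Suc m)
    let ?w = "M - real (Suc m)"
    have w: "?w > 0" "?w + 1 = M - real m"
      using Suc.prems by (auto simp: M_def)
    obtain z where z: "z \<in> X" "(norm (x (Suc m) - z))\<^sup>2 / (?w + 1)\<^sup>2 + 2 * c * f z
        \<le> R\<^sup>2 / M\<^sup>2 + 2 * c * f xstar + real m * (c\<^sup>2 * B\<^sup>2)"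
      using Suc.IH Suc.prems unfolding w by auto
    have x: "x (Suc m) \<in> X" using x_mem[of m] Suc.prems by simp
    have g: "g (Suc m) \<in> subdifferential D f (x (Suc m))"
      using assms(14) Suc.prems by simp
    obtain z' where "z' \<in> X" "(norm (x (Suc m + 1) - z'))\<^sup>2 / ?w\<^sup>2 + 2 * c * f z'
        \<le> (norm (x (Suc m) - z))\<^sup>2 / (?w + 1)\<^sup>2 + 2 * c * f z + c\<^sup>2 * B\<^sup>2"
      using potential_step[OF \<open>closed X\<close> \<open>convex X\<close> \<open>X \<subseteq> D\<close> \<open>convex_on D f\<close> x z(1) g
          bound[OF x g] w(1), of c] c step[of "Suc m"] Suc.prems
      by (metis One_nat_def Suc_leI atLeastAtMost_iff less_imp_le zero_less_Suc)
    then show ?case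
      using z(2) by (intro bexI[of _ z']) (auto simp: algebra_simps)
  qed
  obtain z where z: "z \<in> X"
    and pot: "(norm (x (N + 1) - z))\<^sup>2 + 2 * c * f z
      \<le> R\<^sup>2 / M\<^sup>2 + 2 * c * f xstar + real N * (c\<^sup>2 * B\<^sup>2)"
    using potential[of N] by (auto simp: M_def)
  have x: "x (N + 1) \<in> X" using x_mem[of N] by simp
  \<comment> \<open>The method computes no subgradient at the last iterate; any element of the
    nonempty subdifferential there serves.\<close>
  obtain v where v: "v \<in> subdifferential D f (x (N + 1))"
    using assms(9) x by blast
  have "f (x (N + 1)) - f z \<le> v \<bullet> (x (N + 1) - z)"
    using v z \<open>X \<subseteq> D\<close> by (force simp: subdifferential_def inner_diff_right)
  also have "\<dots> \<le> norm v * norm (x (N + 1) - z)"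
    by (rule norm_cauchy_schwarz)
  also have "\<dots> \<le> B * norm (x (N + 1) - z)"
    using bound[OF x v] by (intro mult_right_mono) auto
  finally have "2 * c * (f (x (N + 1)) - f z) \<le> 2 * c * (B * norm (x (N + 1) - z))"
    using c by (intro mult_left_mono) auto
  \<comment> \<open>By \<open>2ab \<le> a\<^sup>2 + b\<^sup>2\<close>, the squared distance cancels
    against the one in \<open>pot\<close>, and the remainder is one more error term, raising their
    number from \<open>N\<close> to \<open>M\<close>.\<close>
  also have "\<dots> \<le> (norm (x (N + 1) - z))\<^sup>2 + c\<^sup>2 * B\<^sup>2"
    using sum_squares_bound[of "norm (x (N + 1) - z)" "c * B"]
    by (simp add: algebra_simps power_mult_distrib)
  finally have main: "2 * c * (f (x (N + 1)) - f xstar) \<le> R\<^sup>2 / M\<^sup>2 + M * (c\<^sup>2 * B\<^sup>2)"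
    using pot by (simp add: M_def algebra_simps)
  have "M * (c\<^sup>2 * B\<^sup>2) = R\<^sup>2 / M\<^sup>2"
    using \<open>B > 0\<close> M by (simp add: c_def power_divide power_mult_distrib power2_eq_square power3_eq_cube)
  moreover have "R\<^sup>2 / M\<^sup>2 = c * (B * R / sqrt M)"
  proof -
    have "sqrt (M ^ 3) = M * sqrt M"
      using M by (simp add: real_sqrt_mult power3_eq_cube)
    then have "sqrt (M ^ 3) * sqrt M = M\<^sup>2"
      using M by (simp add: mult.assoc power2_eq_square)
    then show ?thesis
      using \<open>B > 0\<close> by (simp add: c_def power2_eq_square)
  qed
  ultimately have "c * (f (x (N + 1)) - f xstar) \<le> c * (B * R / sqrt M)"
    using main by linarith
  then show ?thesis
    using c by (simp only: M_def mult_le_cancel_left_pos)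
qed

end
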